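(* For each integer $m\geq 0$, $$\frac{\pi}{4} = \sum_{n=0}^\infty \frac{(-1)^{n}}{2n+1}\frac{L_{2m(2n+1)}^2}{(t + \sqrt{t^2+1})^{2n+1}},$$ where $$t = t(m) = \frac{L_{2m}^2 + \sqrt{L_{2m}^4 + 8L_{2m}^2 - 16}}{4}$$ and $L_k$ denotes the $k$-th Lucas number.
   Context: The Lucas numbers are defined by $L_0=2$, $L_1=1$, and $L_{n+2}=L_{n+1}+L_n$ for $n\ge 0$. *)

theory Defs
  imports Complex_Main
begin

fun lucas :: "nat \<Rightarrow> nat" where
  "lucas 0 = 2"
| "lucas (Suc 0) = 1"
| "lucas (Suc (Suc n)) = lucas (Suc n) + lucas n"

definition lucas_t :: "nat \<Rightarrow> real" where
  "lucas_t m =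
     (real (lucas (2 * m)) ^ 2
        + sqrt (real (lucas (2 * m)) ^ 4 + 8 * real (lucas (2 * m)) ^ 2 - 16)) / 4"

end

theory Submission imports Defs begin

text \<open>
  With \<open>a, b\<close> the \<open>4 m\<close>-th powers of the golden ratio and its conjugate, \<open>a b = 1\<close> and the
  squared Lucas number of index \<open>2 m N\<close> is \<open>a ^ N + b ^ N + 2\<close>. With \<open>x = 1 / (t + sqrt (t\<^sup>2 + 1))\<close>
  the series is therefore \<open>arctan (a x) + arctan (b x) + 2 arctan x\<close>. Since \<open>x / (1 - x\<^sup>2) = 1 / (2 t)\<close>,
  the addition formula turns this into \<open>arctan ((L\<^sup>2 - 2) / (2 t)) + arctan (1 / t)\<close>, and the
  choice of \<open>t\<close> as a root of \<open>2 t\<^sup>2 - L\<^sup>2 t - (L\<^sup>2 - 2)\<close> makes the tangent of the sum equal to \<open>1\<close>.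
\<close>

text \<open>Both \<open>p\<close> and \<open>q\<close> are roots of z^2 = z + 1, so their powers
  obey the Lucas recurrence.\<close>

lemma lucas_eq_powers:
  fixes p q :: real
  assumes "p + q = 1" "p * q = -1"
  shows "real (lucas n) = p ^ n + q ^ n"
proof (induction n rule: lucas.induct)
  case (3 n)
  have q: "q = 1 - p" using assms(1) by simp
  have p2: "p ^ 2 = p + 1" and q2: "q ^ 2 = q + 1"
    using assms(2) unfolding q by (simp_all add: power2_eq_square algebra_simps)
  have "p ^ Suc (Suc n) + q ^ Suc (Suc n) = p ^ n * p ^ 2 + q ^ n * q ^ 2"
    by (simp add: power2_eq_square)
  also have "\<dots> = (p ^ Suc n + q ^ Suc n) + (p ^ n + q ^ n)"
    by (simp add: p2 q2 algebra_simps)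
  finally show ?case using 3 by simp
qed (use assms in simp_all)

text \<open>Squaring \<open>p ^ k + q ^ k\<close> leaves the cross term
  \<open>2 * (p * q) ^ k\<close>, which is 2 because k = 2 m N is even.\<close>

lemma lucas_even_square:
  obtains a b :: real where "a > 0" "b > 0" "a * b = 1"
    "\<And>N. real (lucas (2 * m * N)) ^ 2 = a ^ N + b ^ N + 2"
proof -
  define p q :: real where "p = (1 + sqrt 5) / 2" and "q = (1 - sqrt 5) / 2"
  have pq: "p + q = 1" "p * q = -1"
    by (simp_all add: p_def q_def field_simps)
  then have nz: "p \<noteq> 0" "q \<noteq> 0" by auto
  show thesis
  proof
    \<comment> \<open>Since \<open>q\<close> is negative, the even exponent is essential.\<close>
    show "p ^ (4 * m) > 0" "q ^ (4 * m) > 0"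
      using nz by (simp_all add: zero_less_power_eq)
    show "p ^ (4 * m) * q ^ (4 * m) = 1"
      by (simp add: pq flip: power_mult_distrib)
    fix N
    have "real (lucas (2 * m * N)) ^ 2
        = (p ^ (2 * m * N)) ^ 2 + (q ^ (2 * m * N)) ^ 2 + 2 * (p * q) ^ (2 * m * N)"
      by (simp add: lucas_eq_powers[OF pq] power2_sum power_mult_distrib)
    also have "\<dots> = (p ^ (4 * m)) ^ N + (q ^ (4 * m)) ^ N + 2"
      by (simp add: pq(2) ac_simps flip: power_mult)
    finally show "real (lucas (2 * m * N)) ^ 2 = (p ^ (4 * m)) ^ N + (q ^ (4 * m)) ^ N + 2" .
  qed
qed

lemma arctan_sums:
  fixes x :: real
  assumes "\<bar>x\<bar> \<le> 1"
  shows "(\<lambda>n. (- 1) ^ n / real (2 * n + 1) * x ^ (2 * n + 1)) sums arctan x"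
  using summable_sums[OF summable_arctan_series[OF assms]]
  unfolding arctan_series[OF assms] by (simp add: mult.commute)

theorem theorem7:
  fixes m :: nat
  shows "(\<lambda>n. (- 1) ^ n / real (2 * n + 1)
            * (real (lucas (2 * m * (2 * n + 1))) ^ 2
               / (lucas_t m + sqrt (lucas_t m ^ 2 + 1)) ^ (2 * n + 1)))
         sums (pi / 4)"
proof -
  obtain a b :: real where ab: "a > 0" "b > 0" "a * b = 1"
    and luc: "\<And>N. real (lucas (2 * m * N)) ^ 2 = a ^ N + b ^ N + 2"
    using lucas_even_square[of m] by blast
  define s where "s = real (lucas (2 * m)) ^ 2"
  define t where "t = lucas_t m"
  define u where "u = t + sqrt (t ^ 2 + 1)"
  define x where "x = 1 / u"
  have s: "s = a + b + 2" using luc[of 1] by (simp add: s_def)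
  \<comment> \<open>AM-GM under \<open>a * b = 1\<close>. The resulting bound s \<ge> 4 keeps the
    radicand in \<open>t\<close> at least s^2.\<close>
  have "(a + b) ^ 2 = (a - b) ^ 2 + 2 ^ 2"
    using ab(3) by (simp add: power2_sum power2_diff)
  then have "2 ^ 2 \<le> (a + b) ^ 2" by simp
  then have "2 \<le> a + b" by (rule power2_le_imp_le) (use ab in simp)
  then have s4: "s \<ge> 4" using s by simp
  have t: "t = (s + sqrt (s ^ 2 + 8 * s - 16)) / 4"
    by (simp add: t_def lucas_t_def s_def flip: power_mult)
  have "s \<le> sqrt (s ^ 2 + 8 * s - 16)"
    using s4 by (intro real_le_rsqrt) simp
  then have ts: "s / 2 \<le> t" by (simp add: t)
  have "4 * t - s = sqrt (s ^ 2 + 8 * s - 16)" unfolding t by argo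
  moreover have "0 \<le> s ^ 2 + 8 * s - 16" using s4 zero_le_power2[of s] by linarith
  ultimately have "(4 * t - s) ^ 2 = s ^ 2 + 8 * s - 16" by simp
  then have quad: "2 * t ^ 2 - s * t - (s - 2) = 0"
    by (simp add: power2_eq_square algebra_simps)
  have t2: "t \<ge> 2" using ts s4 by simp
  have "t < sqrt (t ^ 2 + 1)" by (intro real_less_rsqrt) simp
  then have u: "u > s" using ts by (simp add: u_def)
  have u0: "u > 0" using u s4 by simp
  have "(u - t) ^ 2 = t ^ 2 + 1" by (simp add: u_def)
  then have uq: "u ^ 2 - 1 = 2 * t * u" by (simp add: power2_eq_square algebra_simps)
  \<comment> \<open>The upper bounds come from u > s = a + b + 2. They serve both the addition
    formula and the convergence of the three series.\<close>
  have bnd: "0 < x" "x < 1" "0 < a * x" "a * x < 1" "0 < b * x" "b * x < 1"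
    using u u0 s s4 ab by (simp_all add: x_def field_simps)
  have "u * x = 1" using u0 by (simp add: x_def)
  with uq have x2: "1 - x ^ 2 = 2 * t * x" by algebra
  have "arctan (a * x) + arctan (b * x) = arctan ((a * x + b * x) / (1 - (a * x) * (b * x)))"
    using bnd by (intro arctan_add) auto
  also have "(a * x) * (b * x) = x ^ 2"
    using ab(3) by algebra
  also have "(a * x + b * x) / (1 - x ^ 2) = (s - 2) / (2 * t)"
    unfolding x2 using bnd t2 by (simp add: s field_simps)
  finally have A: "arctan (a * x) + arctan (b * x) = arctan ((s - 2) / (2 * t))" .
  have "arctan x + arctan x = arctan ((x + x) / (1 - x * x))"
    using bnd by (intro arctan_add) auto
  also have "x * x = x ^ 2" by (simp add: power2_eq_square)
  also have "(x + x) / (1 - x ^ 2) = 1 / t"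
    unfolding x2 using bnd t2 by (simp add: field_simps)
  finally have B: "2 * arctan x = arctan (1 / t)" by simp
  \<comment> \<open>Both arguments lie below 1: the first since 2 t \<ge> s, the second since t
    \<ge> 2.\<close>
  have "arctan ((s - 2) / (2 * t)) + arctan (1 / t)
      = arctan (((s - 2) / (2 * t) + 1 / t) / (1 - (s - 2) / (2 * t) * (1 / t)))"
    using t2 ts s4 by (intro arctan_add) (simp_all add: field_simps)
  also have "((s - 2) / (2 * t) + 1 / t) / (1 - (s - 2) / (2 * t) * (1 / t)) = 1"
  proof -
    \<comment> \<open>By \<open>quad\<close>, 2 t^2 - (s - 2) = s t, so numerator and denominator
      coincide.\<close>
    have "1 - (s - 2) / (2 * t) * (1 / t) = s * t / (2 * t ^ 2)"
      using quad t2 by (simp add: field_simps power2_eq_square)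
    moreover have "(s - 2) / (2 * t) + 1 / t = s * t / (2 * t ^ 2)"
      using t2 by (simp add: field_simps power2_eq_square)
    ultimately show ?thesis using s4 t2 by simp
  qed
  finally have total: "arctan (a * x) + arctan (b * x) + 2 * arctan x = pi / 4"
    using A B by (simp add: arctan_one)
  \<comment> \<open>The weights 1, 1, 2 mirror a^N + b^N + 2 at N = 2 n + 1.\<close>
  have "(\<lambda>n. (- 1) ^ n / real (2 * n + 1) * (a * x) ^ (2 * n + 1)
          + (- 1) ^ n / real (2 * n + 1) * (b * x) ^ (2 * n + 1)
          + 2 * ((- 1) ^ n / real (2 * n + 1) * x ^ (2 * n + 1)))
        sums (arctan (a * x) + arctan (b * x) + 2 * arctan x)"
    using bnd by (intro sums_add sums_mult arctan_sums) simp_all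
  moreover have "(- 1) ^ n / real (2 * n + 1) * (a * x) ^ (2 * n + 1)
          + (- 1) ^ n / real (2 * n + 1) * (b * x) ^ (2 * n + 1)
          + 2 * ((- 1) ^ n / real (2 * n + 1) * x ^ (2 * n + 1))
      = (- 1) ^ n / real (2 * n + 1)
          * (real (lucas (2 * m * (2 * n + 1))) ^ 2 / u ^ (2 * n + 1))" for n
    unfolding luc power_mult_distrib x_def power_one_over
    by (simp only: distrib_left divide_inverse distrib_right mult_ac mult_1_left)
  ultimately show ?thesis
    unfolding total by (simp only: u_def t_def)
qed

end
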